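(* Let $\mathbf{H}$ be a hoop with universe $H$. The set $J=\{x\in H \mid x+x=x\}$ of idempotent elements of $\mathbf{H}$ is the universe of a subhoop of $\mathbf{H}$ (i.e., $0\in J$ and $J$ is closed under $+$ and $\rightarrow$).
   Context: A pocrim is a structure $\mathbf{P}=(P;0,+,\rightarrow)$ such that, writing $x\ge y$ for $x\rightarrow y=0$: $(P;0,+)$ is a commutative monoid; $\ge$ is a partial order on $P$; $x\ge y$ implies $x+z\ge y+z$; $x\ge 0$ for all $x$; and $x+y\ge z$ iff $x\ge y\rightarrow z$. A hoop is a pocrim satisfying $x+(x\rightarrow y)=y+(y\rightarrow x)$. *)

theory Defs
  imports "HOL-Algebra.Group"
begin

record 'a pocrim_struct = "'a partial_object" +
  pzero :: 'a  ("\<zero>\<index>")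
  padd :: "'a \<Rightarrow> 'a \<Rightarrow> 'a"  (infixl "\<oplus>\<index>" 65)
  pimp :: "'a \<Rightarrow> 'a \<Rightarrow> 'a"  (infixr "\<rightarrow>\<index>" 60)

text \<open>The order is dual to the usual one for residuated structures: \<open>\<zero>\<close> is the least element.\<close>

definition pge :: "('a, 'b) pocrim_struct_scheme \<Rightarrow> 'a \<Rightarrow> 'a \<Rightarrow> bool"  (infix "\<succeq>\<index>" 50)
  where "x \<succeq>\<^bsub>P\<^esub> y \<longleftrightarrow> x \<rightarrow>\<^bsub>P\<^esub> y = \<zero>\<^bsub>P\<^esub>"

locale pocrim =
  fixes P (structure)
  assumes comm_monoid: "comm_monoid \<lparr>carrier = carrier P, mult = padd P, one = \<zero>\<rparr>"
    and imp_closed: "\<lbrakk>x \<in> carrier P; y \<in> carrier P\<rbrakk> \<Longrightarrow> x \<rightarrow> y \<in> carrier P"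
    and partial_order:
      "partial_order_on (carrier P) {(x, y). x \<in> carrier P \<and> y \<in> carrier P \<and> x \<succeq> y}"
    and add_mono:
      "\<lbrakk>x \<in> carrier P; y \<in> carrier P; z \<in> carrier P; x \<succeq> y\<rbrakk> \<Longrightarrow> x \<oplus> z \<succeq> y \<oplus> z"
    and ge_zero: "x \<in> carrier P \<Longrightarrow> x \<succeq> \<zero>"
    and residuation:
      "\<lbrakk>x \<in> carrier P; y \<in> carrier P; z \<in> carrier P\<rbrakk> \<Longrightarrow> x \<oplus> y \<succeq> z \<longleftrightarrow> x \<succeq> (y \<rightarrow> z)"

locale hoop = pocrim H for H (structure) +
  assumes divisibility:
    "\<lbrakk>x \<in> carrier H; y \<in> carrier H\<rbrakk> \<Longrightarrow> x \<oplus> (x \<rightarrow> y) = y \<oplus> (y \<rightarrow> x)"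

locale subhoop =
  fixes J and H (structure)
  assumes subset: "J \<subseteq> carrier H"
    and zero_mem: "\<zero> \<in> J"
    and add_mem: "\<lbrakk>x \<in> J; y \<in> J\<rbrakk> \<Longrightarrow> x \<oplus> y \<in> J"
    and imp_mem: "\<lbrakk>x \<in> J; y \<in> J\<rbrakk> \<Longrightarrow> x \<rightarrow> y \<in> J"

text \<open>The closure conditions suffice for \<open>J\<close>, with the restricted operations, to be a hoop.\<close>

lemma subhoop_is_hoop:
  assumes "hoop H" and "subhoop J H"
  shows "hoop (H\<lparr>carrier := J\<rparr>)"
proof -
  interpret hoop H by fact
  interpret S: subhoop J H by fact
  interpret M: comm_monoid "\<lparr>carrier = carrier H, mult = padd H, one = \<zero>\<^bsub>H\<^esub>\<rparr>"
    by (rule comm_monoid)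
  have sub: "x \<in> carrier H" if "x \<in> J" for x
    using that S.subset by blast
  have ge: "x \<succeq>\<^bsub>H\<lparr>carrier := J\<rparr>\<^esub> y \<longleftrightarrow> x \<succeq>\<^bsub>H\<^esub> y" for x y
    by (simp add: pge_def)
  show ?thesis
  proof (intro hoop.intro pocrim.intro hoop_axioms.intro)
    show "comm_monoid \<lparr>carrier = carrier (H\<lparr>carrier := J\<rparr>), mult = padd (H\<lparr>carrier := J\<rparr>),
        one = \<zero>\<^bsub>H\<lparr>carrier := J\<rparr>\<^esub>\<rparr>"
    proof (rule comm_monoidI, goal_cases)
      case (1 x y) then show ?case by (simp add: S.add_mem)
    next
      case 2 then show ?case by (simp add: S.zero_mem)
    next
      case (3 x y z) then show ?case using M.m_assoc[of x y z] sub by simp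
    next
      case (4 x) then show ?case using M.l_one[of x] sub by simp
    next
      case (5 x y) then show ?case using M.m_comm[of x y] sub by simp
    qed
    show "partial_order_on (carrier (H\<lparr>carrier := J\<rparr>))
        {(x, y). x \<in> carrier (H\<lparr>carrier := J\<rparr>) \<and> y \<in> carrier (H\<lparr>carrier := J\<rparr>)
                 \<and> x \<succeq>\<^bsub>H\<lparr>carrier := J\<rparr>\<^esub> y}"
      using partial_order sub unfolding ge partial_order_on_def preorder_on_def
        refl_on_def antisym_def trans_def by auto blast+
  next
    fix x y assume "x \<in> carrier (H\<lparr>carrier := J\<rparr>)" "y \<in> carrier (H\<lparr>carrier := J\<rparr>)"
    then show "x \<rightarrow>\<^bsub>H\<lparr>carrier := J\<rparr>\<^esub> y \<in> carrier (H\<lparr>carrier := J\<rparr>)"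
      by (simp add: S.imp_mem)
  next
    fix x y z
    assume "x \<in> carrier (H\<lparr>carrier := J\<rparr>)" "y \<in> carrier (H\<lparr>carrier := J\<rparr>)"
      "z \<in> carrier (H\<lparr>carrier := J\<rparr>)" "x \<succeq>\<^bsub>H\<lparr>carrier := J\<rparr>\<^esub> y"
    then show "x \<oplus>\<^bsub>H\<lparr>carrier := J\<rparr>\<^esub> z \<succeq>\<^bsub>H\<lparr>carrier := J\<rparr>\<^esub> y \<oplus>\<^bsub>H\<lparr>carrier := J\<rparr>\<^esub> z"
      using add_mono sub by (simp add: ge)
  qed (use ge_zero residuation divisibility sub in \<open>simp_all add: ge\<close>)
qed

end

theory Submission
  imports Defs
begin

text \<open>
  Closure under \<open>\<rightarrow>\<close>: let \<open>a\<close>, \<open>b\<close> be idempotent, \<open>c = a \<rightarrow> b\<close> and \<open>d = c \<rightarrow> c + c\<close>. From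
  \<open>a + c \<ge> b = b + b \<ge> c + c\<close> we get \<open>a \<ge> d\<close>, so \<open>d \<rightarrow> c \<ge> a \<rightarrow> c = (a + a) \<rightarrow> b = c\<close>. As \<open>c \<ge> d\<close>,
  divisibility gives \<open>c = d + (d \<rightarrow> c) \<ge> d + c \<ge> c + c\<close>.
\<close>

context pocrim
begin

interpretation add: comm_monoid "\<lparr>carrier = carrier P, mult = padd P, one = \<zero>\<rparr>"
  by (rule comm_monoid)

lemma zero_closed: "\<zero> \<in> carrier P"
  using add.one_closed by simp

lemma add_closed: "\<lbrakk>x \<in> carrier P; y \<in> carrier P\<rbrakk> \<Longrightarrow> x \<oplus> y \<in> carrier P"
  using add.m_closed by simp

lemma add_assoc:
  "\<lbrakk>x \<in> carrier P; y \<in> carrier P; z \<in> carrier P\<rbrakk> \<Longrightarrow> x \<oplus> y \<oplus> z = x \<oplus> (y \<oplus> z)"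
  using add.m_assoc by simp

lemma add_comm: "\<lbrakk>x \<in> carrier P; y \<in> carrier P\<rbrakk> \<Longrightarrow> x \<oplus> y = y \<oplus> x"
  using add.m_comm by simp

lemma add_zero: "x \<in> carrier P \<Longrightarrow> x \<oplus> \<zero> = x"
  using add.r_one by simp

lemma add_left_comm:
  "\<lbrakk>x \<in> carrier P; y \<in> carrier P; z \<in> carrier P\<rbrakk> \<Longrightarrow> x \<oplus> (y \<oplus> z) = y \<oplus> (x \<oplus> z)"
  using add.m_lcomm by simp

lemma ge_refl: "x \<in> carrier P \<Longrightarrow> x \<succeq> x"
  using partial_order by (auto simp: partial_order_on_def preorder_on_def refl_on_def)

lemma ge_trans:
  "\<lbrakk>x \<succeq> y; y \<succeq> z; x \<in> carrier P; y \<in> carrier P; z \<in> carrier P\<rbrakk> \<Longrightarrow> x \<succeq> z"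
  using partial_order unfolding partial_order_on_def preorder_on_def trans_def by blast

lemma ge_antisym: "\<lbrakk>x \<succeq> y; y \<succeq> x; x \<in> carrier P; y \<in> carrier P\<rbrakk> \<Longrightarrow> x = y"
  using partial_order unfolding partial_order_on_def antisym_def by blast

lemma add_mono_left:
  assumes "x \<succeq> y" "x \<in> carrier P" "y \<in> carrier P" "z \<in> carrier P"
  shows "z \<oplus> x \<succeq> z \<oplus> y"
  using add_mono[of x y z] assms by (simp add: add_comm[of z])

lemma add_mono_both:
  assumes "x \<succeq> y" "u \<succeq> v" "x \<in> carrier P" "y \<in> carrier P" "u \<in> carrier P" "v \<in> carrier P"
  shows "x \<oplus> u \<succeq> y \<oplus> v"
  using ge_trans[OF add_mono[of x y u] add_mono_left[of u v y]] assms by (simp add: add_closed)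

lemma add_ge_left:
  assumes "x \<in> carrier P" "y \<in> carrier P"
  shows "x \<oplus> y \<succeq> x"
  using add_mono_left[of y \<zero> x] assms by (simp add: ge_zero zero_closed add_zero)

text \<open>Modus ponens: residuation applied to reflexivity at
  \<open>x \<rightarrow> y\<close>.\<close>

lemma imp_add_ge:
  assumes "x \<in> carrier P" "y \<in> carrier P"
  shows "(x \<rightarrow> y) \<oplus> x \<succeq> y"
  using residuation[of "x \<rightarrow> y" x y] assms by (simp add: imp_closed ge_refl)

text \<open>Weakening: by residuation this is \<open>y \<oplus> x \<succeq> y\<close>, an instance
  of \<open>add_ge_left\<close>.\<close>

lemma ge_imp:
  assumes "x \<in> carrier P" "y \<in> carrier P"
  shows "y \<succeq> x \<rightarrow> y"
  using residuation[of y x y] assms by (simp add: add_ge_left)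

end

lemma (in hoop) imp_idempotent:
  assumes a: "a \<in> carrier H" "a \<oplus> a = a" and b: "b \<in> carrier H" "b \<oplus> b = b"
  shows "(a \<rightarrow> b) \<oplus> (a \<rightarrow> b) = a \<rightarrow> b"
proof -
  define c where "c = a \<rightarrow> b"
  \<comment> \<open>By residuation \<open>d\<close> is the least \<open>x\<close> with
    \<open>x \<oplus> c \<succeq> c \<oplus> c\<close>, so it measures the failure of idempotence:
    it is \<open>\<zero>\<close> exactly when \<open>c\<close> is idempotent.\<close>
  define d where "d = c \<rightarrow> c \<oplus> c"
  define f where "f = d \<rightarrow> c"
  have C: "c \<in> carrier H" "c \<oplus> c \<in> carrier H" "d \<in> carrier H" "f \<in> carrier H"
    using a b by (simp_all add: c_def d_def f_def imp_closed add_closed)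
  have "b \<succeq> c"
    using a b by (simp add: c_def ge_imp)
  \<comment> \<open>Idempotence of \<open>b\<close> enters here: \<open>b\<close> is read as
    \<open>b \<oplus> b\<close>.\<close>
  then have "b \<succeq> c \<oplus> c"
    using add_mono_both[of b c b c] b C by simp
  moreover have "a \<oplus> c \<succeq> b"
    using imp_add_ge[of a b] a b C by (simp add: c_def add_comm)
  ultimately have "a \<oplus> c \<succeq> c \<oplus> c"
    using ge_trans[of "a \<oplus> c" b "c \<oplus> c"] a b C by (simp add: add_closed)
  then have "a \<succeq> d"
    using residuation a C by (simp add: d_def)
  then have "f \<oplus> a \<succeq> f \<oplus> d"
    using add_mono_left a C by blast
  moreover have "f \<oplus> d \<succeq> c"
    using imp_add_ge C by (simp add: f_def)
  ultimately have "f \<oplus> a \<succeq> c"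
    using ge_trans[of "f \<oplus> a" "f \<oplus> d" c] a C by (simp add: add_closed)
  then have "f \<oplus> a \<oplus> a \<succeq> b"
    using residuation[of "f \<oplus> a" a b] a b C by (simp add: c_def add_closed)
  \<comment> \<open>Idempotence of \<open>a\<close> merges the two copies of \<open>a\<close>, and
    residuation then returns to \<open>a \<rightarrow> b\<close>.\<close>
  then have "f \<succeq> c"
    using residuation[of f a b] a b C by (simp add: add_assoc c_def)
  then have "d \<oplus> f \<succeq> d \<oplus> c"
    using add_mono_left C by blast
  \<comment> \<open>Here \<open>c \<rightarrow> d = \<zero>\<close>: by residuation
    \<open>c \<succeq> d\<close> says \<open>c \<oplus> c \<succeq> c \<oplus> c\<close>.\<close>
  moreover have "c \<oplus> (c \<rightarrow> d) = c"
    using ge_refl residuation[of c c "c \<oplus> c"] C by (simp add: d_def pge_def add_zero)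
  \<comment> \<open>Divisibility swaps \<open>d \<oplus> (d \<rightarrow> c)\<close> for
    \<open>c \<oplus> (c \<rightarrow> d)\<close>; this is where the hoop axiom goes beyond the
    pocrim laws.\<close>
  then have "d \<oplus> f = c"
    using divisibility[of c d] C by (simp add: f_def)
  moreover have "d \<oplus> c \<succeq> c \<oplus> c"
    using imp_add_ge C by (simp add: d_def)
  ultimately have "c \<succeq> c \<oplus> c"
    using ge_trans[of c "d \<oplus> c" "c \<oplus> c"] C by (simp add: add_closed)
  \<comment> \<open>The opposite inequality \<open>c \<oplus> c \<succeq> c\<close> holds for every
    element.\<close>
  then show ?thesis
    using ge_antisym[of "c \<oplus> c" c] add_ge_left C by (simp add: c_def)
qed

theorem theorem4p5p1:
  fixes H (structure)
  assumes "hoop H"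
  shows "subhoop {x \<in> carrier H. x \<oplus> x = x} H"
proof -
  interpret hoop H by fact
  show ?thesis
  proof
    fix x y
    assume "x \<in> {x \<in> carrier H. x \<oplus> x = x}" "y \<in> {x \<in> carrier H. x \<oplus> x = x}"
    then have x: "x \<in> carrier H" "x \<oplus> x = x" and y: "y \<in> carrier H" "y \<oplus> y = y"
      by auto
    \<comment> \<open>Closure under \<open>\<oplus>\<close> is pure commutative monoid algebra: the
      four summands are regrouped.\<close>
    have "x \<oplus> y \<oplus> (x \<oplus> y) = (x \<oplus> x) \<oplus> (y \<oplus> y)"
      using x(1) y(1) by (simp add: add_assoc add_left_comm add_closed)
    then show "x \<oplus> y \<in> {x \<in> carrier H. x \<oplus> x = x}"
      using x y by (simp add: add_closed)
    show "x \<rightarrow> y \<in> {x \<in> carrier H. x \<oplus> x = x}"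
      using x y by (simp add: imp_closed imp_idempotent)
  qed (auto simp: zero_closed add_zero)
qed

end
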